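(* Let $n\ge2$ and $k,N\ge1$ be integers and let $h(t)=t^{2k}$. Then for every $N$-point code $C\subset\mathbb S^{n-1}$, $$m^h(C)\ \le\ c_{2k}N\ \le\ M^h(C),$$ where $c_{2k}=\dfrac{1\cdot3\cdots(2k-1)}{n(n+2)\cdots(n+2k-2)}$. Each of these two inequalities becomes an equality if and only if $C$ is an $N$-point spherical $(k,k)$-design on $\mathbb S^{n-1}$. Moreover, if an $N$-point spherical $(k,k)$-design exists on $\mathbb S^{n-1}$, then $m_N^h=M_N^h=c_{2k}N$.
   Context: $\mathbb S^{n-1}$ is the unit sphere in $\mathbb R^n$; a code is a finite nonempty set $C=\{x_1,\dots,x_N\}\subset\mathbb S^{n-1}$, $|C|=N$. Gegenbauer polynomials: $P_\ell^{(n)}$, $\ell\ge0$, are the polynomials with $\deg P_\ell^{(n)}=\ell$, pairwise orthogonal on $[-1,1]$ with respect to the weight $(1-t^2)^{(n-3)/2}$, normalized by $P_\ell^{(n)}(1)=1$. A code $C=\{x_1,\dots,x_N\}$ is a spherical $(k,k)$-design if $\sum_{i,j=1}^N P_\ell^{(n)}(x_i\cdot x_j)=0$ for every even $\ell=2,4,\dots,2k$. Potentials: $U^h(x,C)=\sum_{i=1}^N h(x\cdot x_i)$ for $x\in\mathbb S^{n-1}$; $m^h(C)=\inf_{x\in\mathbb S^{n-1}}U^h(x,C)$ and $M^h(C)=\sup_{x\in\mathbb S^{n-1}}U^h(x,C)$; $m_N^h=\sup\{m^h(C): C\subset\mathbb S^{n-1},\ |C|=N\}$ and $M_N^h=\inf\{M^h(C):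 C\subset\mathbb S^{n-1},\ |C|=N\}$. The constant $c_{2k}$ equals $\int_{\mathbb S^{n-1}}(z\cdot y)^{2k}\,d\sigma_n(y)$ for any $z\in\mathbb S^{n-1}$, where $\sigma_n$ is the normalized surface measure on $\mathbb S^{n-1}$. *)

theory Defs
  imports "HOL-Analysis.Analysis" "HOL-Computational_Algebra.Polynomial"
begin

definition is_gegenbauer_family :: "nat \<Rightarrow> (nat \<Rightarrow> real poly) \<Rightarrow> bool" where
  "is_gegenbauer_family n P \<longleftrightarrow>
     (\<forall>l. degree (P l) = l) \<and>
     (\<forall>i j. i \<noteq> j \<longrightarrow>
        integral {-1..1}
          (\<lambda>t. poly (P i) t * poly (P j) t * (1 - t\<^sup>2) powr ((real n - 3) / 2)) = 0) \<and>
     (\<forall>l. poly (P l) 1 = 1)"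

text \<open>For \<open>n \<ge> 2\<close> the weight is integrable on \<open>{-1..1}\<close> and there is exactly one such family.\<close>

definition gegenbauer :: "nat \<Rightarrow> nat \<Rightarrow> real poly" where
  "gegenbauer n = (THE P. is_gegenbauer_family n P)"

definition is_code :: "(real ^ 'n) set \<Rightarrow> bool" where
  "is_code C \<longleftrightarrow> finite C \<and> C \<noteq> {} \<and> C \<subseteq> sphere 0 1"

text \<open>A spherical \<open>(k,k)\<close>-design; the even degrees are \<open>2 * j\<close> with \<open>j \<in> {1..k}\<close>.\<close>

definition is_kk_design :: "nat \<Rightarrow> (real ^ 'n) set \<Rightarrow> bool" where
  "is_kk_design k C \<longleftrightarrow> is_code C \<and>
     (\<forall>j\<in>{1..k}. (\<Sum>x\<in>C. \<Sum>y\<in>C. poly (gegenbauer CARD('n) (2 * j)) (x \<bullet> y)) = 0)"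

definition potential :: "(real \<Rightarrow> real) \<Rightarrow> real ^ 'n \<Rightarrow> (real ^ 'n) set \<Rightarrow> real" where
  "potential h x C = (\<Sum>y\<in>C. h (x \<bullet> y))"

definition pot_inf :: "(real \<Rightarrow> real) \<Rightarrow> (real ^ 'n) set \<Rightarrow> real" where
  "pot_inf h C = (INF x\<in>sphere 0 1. potential h x C)"

definition pot_sup :: "(real \<Rightarrow> real) \<Rightarrow> (real ^ 'n) set \<Rightarrow> real" where
  "pot_sup h C = (SUP x\<in>sphere 0 1. potential h x C)"

text \<open>The optimal values \<open>m\<^sub>N\<close> and \<open>M\<^sub>N\<close> over all \<open>N\<close>-point codes; the type argument carries the
  dimension.  Infima and suprema are taken in \<open>real\<close>, hence meaningful when the values range over
  a nonempty bounded set, as for \<open>h\<close> continuous and \<open>CARD('n) \<ge> 2\<close>, \<open>N \<ge> 1\<close>.\<close>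

definition maxmin_polarization :: "'n::finite itself \<Rightarrow> (real \<Rightarrow> real) \<Rightarrow> nat \<Rightarrow> real" where
  "maxmin_polarization _ h N =
     (SUP C\<in>{C :: (real ^ 'n) set. is_code C \<and> card C = N}. pot_inf h C)"

definition minmax_polarization :: "'n::finite itself \<Rightarrow> (real \<Rightarrow> real) \<Rightarrow> nat \<Rightarrow> real" where
  "minmax_polarization _ h N =
     (INF C\<in>{C :: (real ^ 'n) set. is_code C \<and> card C = N}. pot_sup h C)"

text \<open>The normalized surface measure on the unit sphere, as the radial projection of the uniform
  distribution on the unit ball (\<open>sgn x = x /\<^sub>R norm x\<close>).\<close>

definition sphere_measure :: "(real ^ 'n) measure" where
  "sphere_measure = distr (uniform_measure lborel (ball 0 1)) borel sgn"

text \<open>\<open>sphere_moment n k\<close> is \<open>c\<^sub>2\<^sub>k = (1 * 3 * \<dots> * (2k-1)) / (n * (n+2) * \<dots> * (n+2k-2))\<close>.\<close>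

definition sphere_moment :: "nat \<Rightarrow> nat \<Rightarrow> real" where
  "sphere_moment n k = (\<Prod>i<k. real (2 * i + 1)) / (\<Prod>i<k. real (n + 2 * i))"

end

theory Submission
  imports Defs
begin

text \<open>
  Write \<open>U x = (\<Sum>y\<in>C. (x \<bullet> y) ^ (2 * k))\<close>. Averaging each summand over the sphere gives
  \<open>c\<^sub>2\<^sub>k\<close>, so the mean of \<open>U\<close> is \<open>c\<^sub>2\<^sub>k * N\<close>; it lies between the minimum and the maximum of
  \<open>U\<close>, and because \<open>U\<close> is continuous and the surface measure charges every open set, it equals
  one of them only if \<open>U\<close> is constant (\<open>lower_bound_le_mean\<close>). Everything therefore reduces to
  two facts: the value of the mean, and the equivalence of ``\<open>U\<close> is constant'' with the design
  property (\<open>kk_design_iff_potential_const\<close>).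

  Both the value of the mean and one half of the equivalence come from a single computation. Let
  \<open>X\<close> be a vector-valued function of norm 1 on a finite measure space, and suppose that
  \<open>\<integral> (z \<bullet> X)\<^sup>2\<^sup>k\<close> is the same for all unit vectors \<open>z\<close>. By homogeneity it is a multiple of
  \<open>(norm z)\<^sup>2\<^sup>k\<close>, and taking Laplacians of both sides shows that \<open>\<integral> (z \<bullet> X)\<^sup>2\<^sup>k\<^sup>-\<^sup>2\<close> is constant
  on the sphere as well, with a known ratio of the constants. Descending to exponent 0 determines
  all of them (\<open>moment_eq_sphere_moment\<close>). For the uniform distribution the hypothesis is
  rotation invariance, and the conclusion is the formula for \<open>c\<^sub>2\<^sub>k\<close>. For the counting measure on a
  code the hypothesis says that \<open>U\<close> is constant, and the conclusion is that all lower even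
  potentials are constant too, whence \<open>(\<Sum>x\<in>C. \<Sum>y\<in>C. (x \<bullet> y) ^ (2 * j)) = c\<^sub>2\<^sub>j * N\<^sup>2\<close> for all
  \<open>j \<le> k\<close>.

  These equations say the same as the vanishing of the Gegenbauer sums of degrees \<open>2, 4, \<dots>, 2 * k\<close>:
  the even Gegenbauer polynomials are related to the even monomials by a triangular matrix, and
  the mean of each over the sphere vanishes, by orthogonality to the constants
  (\<open>kk_design_iff_moments\<close>). Finally, the equation for \<open>j = k\<close> alone forces \<open>U\<close> to be constant. In the
  tensor power of order \<open>2 * k\<close>, the squared distance between \<open>\<Sum>y\<in>C. y\<^sup>\<otimes>\<^sup>2\<^sup>k\<close> and \<open>N\<close> times the
  spherical mean of \<open>u\<^sup>\<otimes>\<^sup>2\<^sup>k\<close> is \<open>(\<Sum>x\<in>C. \<Sum>y\<in>C. (x \<bullet> y) ^ (2 * k)) - c\<^sub>2\<^sub>k * N\<^sup>2\<close>; when it is 0, pairing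
  both tensors with \<open>x\<^sup>\<otimes>\<^sup>2\<^sup>k\<close> gives \<open>U x = c\<^sub>2\<^sub>k * N\<close> (\<open>tensor_moment_identity\<close>).

  The Gegenbauer polynomials are introduced as the unique family with their properties, so
  existence and uniqueness have to be established (\<open>gegenbauer_eq\<close>). The three-term recurrence provides
  a candidate, whose weighted integrals against monomials have a closed form; this form gives
  both the orthogonality and the non-degeneracy on which uniqueness rests.
\<close>

section \<open>Rotation invariance of Lebesgue measure\<close>

lemma emeasure_unit_ball:
  "emeasure lborel (ball (0::'a::euclidean_space) 1) \<noteq> 0"
  "emeasure lborel (ball (0::'a::euclidean_space) 1) < \<infinity>"
  using emeasure_lborel_ball_finite[of "0::'a" 1] unit_ball_vol_pos[of "real DIM('a)"]
  by (simp_all add: emeasure_ball del: emeasure_lborel_ball_finite unit_ball_vol_pos)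

lemma borel_measurable_orthogonal:
  fixes f :: "'a::euclidean_space \<Rightarrow> 'a"
  shows "orthogonal_transformation f \<Longrightarrow> f \<in> borel_measurable borel"
  by (intro borel_measurable_continuous_onI linear_continuous_on
      linear_conv_bounded_linear[THEN iffD1] orthogonal_transformation_linear)

text \<open>The argument for the uniqueness of Haar measure. For Borel sets \<open>A\<close> and \<open>B\<close>, the double integral of
  \<open>indicator A (f x) * indicator B (f x + y)\<close> can be evaluated in two ways with Fubini and translation
  invariance, which gives \<open>\<lambda>(f\<^sup>-\<^sup>1A) \<lambda>(B) = \<lambda>(f\<^sup>-\<^sup>1B) \<lambda>(A)\<close>. For the unit ball \<open>B\<close>, which \<open>f\<close>
  preserves, a positive finite factor cancels.\<close>

lemma emeasure_vimage_orthogonal: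
  fixes f :: "'a::euclidean_space \<Rightarrow> 'a"
  assumes f: "orthogonal_transformation f" and A: "A \<in> sets borel"
  shows "emeasure lborel (f -` A) = emeasure lborel A"
proof -
  have lin: "linear f" using f by (rule orthogonal_transformation_linear)
  note borel_measurable_orthogonal[OF f, measurable]
  note A[measurable]
  define B where "B = ball (0::'a) 1"
  have [measurable]: "B \<in> sets borel" by (simp add: B_def)
  have shift: "(\<integral>\<^sup>+x. g (x + c) \<partial>lborel) = (\<integral>\<^sup>+x. g x \<partial>lborel)"
    if [measurable]: "g \<in> borel_measurable borel" for g and c :: 'a
    by (subst (2) lborel_distr_plus[of c, symmetric]) (simp add: nn_integral_distr add.commute)
  have reflect: "(\<integral>\<^sup>+x. g (c - x) \<partial>lborel) = (\<integral>\<^sup>+x. g x \<partial>lborel)"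
    if [measurable]: "g \<in> borel_measurable borel" for g and c :: 'a
  proof -
    have "(\<integral>\<^sup>+x. g x \<partial>lborel) = (\<integral>\<^sup>+x. g x \<partial>distr lborel borel (\<lambda>x. c - x))"
      using lborel_affine[of "-1::real" c] by (simp add: density_1)
    then show ?thesis by (simp add: nn_integral_distr)
  qed
  have pre: "f -` S \<in> sets borel" if "S \<in> sets borel" for S
    using measurable_sets_borel[OF _ that, of f] by simp
  have fB: "f -` B = B"
    using f by (auto simp: B_def orthogonal_transformation_norm)
  have "emeasure lborel (f -` A) * emeasure lborel B
      = (\<integral>\<^sup>+x. indicator A (f x) * (\<integral>\<^sup>+y. indicator B (y + f x) \<partial>lborel) \<partial>lborel)"
    by (subst shift) (simp_all add: nn_integral_multc indicator_vimage[symmetric] pre A)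
  also have "\<dots> = (\<integral>\<^sup>+x. \<integral>\<^sup>+y. indicator A (f x) * indicator B (f x + y) \<partial>lborel \<partial>lborel)"
    by (simp add: nn_integral_cmult add.commute)
  also have "\<dots> = (\<integral>\<^sup>+y. \<integral>\<^sup>+x. indicator A (f x) * indicator B (f x + y) \<partial>lborel \<partial>lborel)"
    by (rule lborel_pair.Fubini'[symmetric]) measurable
  \<comment> \<open>translate \<open>x\<close> by a preimage of \<open>y\<close>\<close>
  also have "\<dots> = (\<integral>\<^sup>+y. \<integral>\<^sup>+x. indicator A (f x - y) * indicator B (f x) \<partial>lborel \<partial>lborel)"
  proof (rule nn_integral_cong)
    fix y
    obtain v where v: "f v = y"
      using orthogonal_transformation_surj[OF f] by (metis surjD)
    have "(\<integral>\<^sup>+x. indicator A (f x) * indicator B (f x + y) \<partial>lborel)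
        = (\<integral>\<^sup>+x. (\<lambda>x. indicator A (f x - y) * indicator B (f x)) (x + v) \<partial>lborel)"
      using v by (simp add: linear_add[OF lin])
    also have "\<dots> = (\<integral>\<^sup>+x. indicator A (f x - y) * indicator B (f x) \<partial>lborel)"
      by (rule shift) measurable
    finally show "(\<integral>\<^sup>+x. indicator A (f x) * indicator B (f x + y) \<partial>lborel)
        = (\<integral>\<^sup>+x. indicator A (f x - y) * indicator B (f x) \<partial>lborel)" .
  qed
  also have "\<dots> = (\<integral>\<^sup>+x. \<integral>\<^sup>+y. indicator A (f x - y) * indicator B (f x) \<partial>lborel \<partial>lborel)"
    by (rule lborel_pair.Fubini') measurable
  also have "\<dots> = (\<integral>\<^sup>+x. (\<integral>\<^sup>+y. indicator A (f x - y) \<partial>lborel) * indicator B (f x) \<partial>lborel)"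
    by (simp add: nn_integral_multc)
  also have "\<dots> = emeasure lborel A * emeasure lborel (f -` B)"
    by (subst reflect) (simp_all add: nn_integral_cmult indicator_vimage[symmetric] pre \<open>B \<in> sets borel\<close>)
  finally have "emeasure lborel (f -` A) * emeasure lborel B = emeasure lborel A * emeasure lborel B"
    by (simp add: fB)
  moreover have "emeasure lborel B \<noteq> 0" "emeasure lborel B \<noteq> \<infinity>"
    using emeasure_unit_ball[where 'a = 'a] by (simp_all add: B_def)
  ultimately show ?thesis
    by (metis ennreal_mult_divide_eq infinity_ennreal_def)
qed

section \<open>Moments of vectors on the unit sphere\<close>

text \<open>Second directional derivatives of powers of \<open>(norm z)\<^sup>2\<close> are read off from this coefficient. Both sides
  carry a factor 2 so that the binomial coefficient \<open>m choose 2\<close> appears without a division.\<close>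

lemma coeff_2_quadratic_power:
  fixes b c :: "'a::{comm_ring_1, ring_char_0}"
  shows "2 * coeff ([:1, b, c:] ^ m) 2 = 2 * of_nat m * c + of_nat m * (of_nat m - 1) * b\<^sup>2"
proof (induction m)
  case (Suc m)
  have c0: "coeff ([:1, b, c:] ^ m) 0 = 1" for m
    by (induction m) auto
  have c1: "coeff ([:1, b, c:] ^ m) 1 = of_nat m * b" for m
    by (induction m) (use c0 in \<open>auto simp: coeff_pCons algebra_simps\<close>)
  have "coeff ([:1, b, c:] ^ Suc m) 2
      = coeff ([:1, b, c:] ^ m) 2 + b * coeff ([:1, b, c:] ^ m) 1 + c * coeff ([:1, b, c:] ^ m) 0"
    by (simp add: coeff_pCons numeral_2_eq_2)
  then show ?case
    using Suc c0[of m] c1[of m] by (simp add: algebra_simps power2_eq_square)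
qed (simp add: numeral_2_eq_2)

text \<open>Instances are \<open>sgn\<close> on the uniform distribution of the unit ball and the identity on the counting
  measure of a code, so that one computation serves both the surface measure and the code.\<close>

locale sphere_vector = finite_measure M for M :: "'b measure" +
  fixes X :: "'b \<Rightarrow> 'a::euclidean_space"
  assumes X_measurable [measurable]: "X \<in> borel_measurable M"
    and AE_norm_X: "AE w in M. norm (X w) = 1"
begin

lemma integrable_inner_powers [simp]:
  "integrable M (\<lambda>w. (v \<bullet> X w) ^ i * (z \<bullet> X w) ^ j)"
proof (rule integrable_const_bound)
  show "AE w in M. norm ((v \<bullet> X w) ^ i * (z \<bullet> X w) ^ j) \<le> norm v ^ i * norm z ^ j"
    using AE_norm_X
  proof eventually_elim
    case (elim w)
    have "\<bar>u \<bullet> X w\<bar> \<le> norm u" for u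
      using Cauchy_Schwarz_ineq2[of u "X w"] elim by simp
    then show ?case
      by (simp add: abs_mult power_abs mult_mono power_mono)
  qed
qed measurable

lemma integrable_inner_power [simp]: "integrable M (\<lambda>w. (z \<bullet> X w) ^ j)"
  using integrable_inner_powers[of z 0 z j] by simp

lemma moment_homogeneous:
  assumes const: "\<And>z. norm z = 1 \<Longrightarrow> (\<integral>w. (z \<bullet> X w) ^ m \<partial>M) = A" and "m > 0"
  shows "(\<integral>w. (z \<bullet> X w) ^ m \<partial>M) = A * norm z ^ m"
proof (cases "z = 0")
  case False
  have "z \<bullet> X w = norm z * (sgn z \<bullet> X w)" for w
    using False by (simp add: sgn_div_norm)
  then have "(\<integral>w. (z \<bullet> X w) ^ m \<partial>M) = (\<integral>w. norm z ^ m * (sgn z \<bullet> X w) ^ m \<partial>M)"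
    by (simp only: power_mult_distrib)
  then show ?thesis
    using const[of "sgn z"] False by (simp add: norm_sgn)
qed (use \<open>m > 0\<close> in simp)

text \<open>Take the Laplacian of \<open>\<integral> (z \<bullet> X)\<^sup>2\<^sup>k\<^sup>+\<^sup>2 = A * (norm z)\<^sup>2\<^sup>k\<^sup>+\<^sup>2\<close> in \<open>z\<close>. Differentiation under the
  integral is avoided: along a line \<open>z + s *\<^sub>R v\<close> both sides are polynomials in \<open>s\<close>, so their
  coefficients at \<open>s\<^sup>2\<close> agree, and these are summed over an orthonormal basis of directions \<open>v\<close>.\<close>

lemma moment_laplacian:
  assumes const: "\<And>z. norm z = 1 \<Longrightarrow> (\<integral>w. (z \<bullet> X w) ^ (2 * Suc k) \<partial>M) = A"
    and z: "norm z = 1"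
  shows "real (2 * k + 1) * (\<integral>w. (z \<bullet> X w) ^ (2 * k) \<partial>M) = A * real (DIM('a) + 2 * k)"
proof -
  define m where "m = 2 * Suc k"
  have second_coeff: "real (Suc k * (2 * k + 1)) * (\<integral>w. (v \<bullet> X w)\<^sup>2 * (z \<bullet> X w) ^ (2 * k) \<partial>M)
      = A * real (Suc k) * (1 + 2 * real k * (z \<bullet> v)\<^sup>2)" if v: "v \<in> Basis" for v
  proof -
    define J where "J i = (\<integral>w. (v \<bullet> X w) ^ i * (z \<bullet> X w) ^ (m - i) \<partial>M)" for i
    define p where "p = (\<Sum>i\<le>m. monom (real (m choose i) * J i) i)"
    define q where "q = smult A ([:1, 2 * (z \<bullet> v), 1:] ^ Suc k)"
    have "poly p s = poly q s" for s
    proof -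
      have "norm (z + s *\<^sub>R v) ^ m = ((norm (z + s *\<^sub>R v))\<^sup>2) ^ Suc k"
        by (simp only: m_def power_mult)
      also have "(norm (z + s *\<^sub>R v))\<^sup>2 = 1 + s * (2 * (z \<bullet> v) + s)"
        using z v unfolding power2_norm_eq_inner
        by (simp add: inner_add algebra_simps inner_commute norm_eq_1)
      finally have "A * norm (z + s *\<^sub>R v) ^ m = poly q s"
        by (simp add: q_def poly_power algebra_simps)
      moreover have "(\<integral>w. ((z + s *\<^sub>R v) \<bullet> X w) ^ m \<partial>M)
          = (\<integral>w. (\<Sum>i\<le>m. (real (m choose i) * s ^ i) * ((v \<bullet> X w) ^ i * (z \<bullet> X w) ^ (m - i))) \<partial>M)"
        by (simp add: inner_add_left add.commute[of "z \<bullet> _"] binomial_ring power_mult_distrib mult_ac)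
      moreover have "\<dots> = (\<Sum>i\<le>m. (real (m choose i) * s ^ i) * J i)"
        by (subst Bochner_Integration.integral_sum) (simp_all add: J_def)
      moreover have "\<dots> = poly p s"
        by (simp add: p_def poly_sum poly_monom mult_ac)
      ultimately show ?thesis
        using moment_homogeneous[of m A "z + s *\<^sub>R v"] const by (simp add: m_def)
    qed
    then have "p = q" by (simp add: poly_eq_poly_eq_iff[symmetric] fun_eq_iff)
    moreover have "coeff p 2 = real (m choose 2) * J 2"
    proof -
      have "2 \<le> m" by (simp add: m_def)
      then show ?thesis by (simp add: p_def coeff_sum)
    qed
    moreover have "m choose 2 = Suc k * (2 * k + 1)"
      by (simp add: m_def choose_two)
    moreover have "m - 2 = 2 * k" by (simp add: m_def)
    ultimately have "real (Suc k * (2 * k + 1)) * (\<integral>w. (v \<bullet> X w)\<^sup>2 * (z \<bullet> X w) ^ (2 * k) \<partial>M)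
        = A * coeff ([:1, 2 * (z \<bullet> v), 1:] ^ Suc k) 2"
      by (simp add: J_def q_def)
    also have "coeff ([:1, 2 * (z \<bullet> v), 1:] ^ Suc k) 2 = real (Suc k) * (1 + 2 * real k * (z \<bullet> v)\<^sup>2)"
      using coeff_2_quadratic_power[of "2 * (z \<bullet> v)" 1 "Suc k"]
      by (simp add: algebra_simps power2_eq_square)
    finally show ?thesis by (simp add: mult.assoc)
  qed
  have parseval: "(\<Sum>v\<in>Basis. (u \<bullet> v)\<^sup>2) = (norm u)\<^sup>2" for u :: 'a
    unfolding power2_norm_eq_inner by (subst euclidean_inner) (simp add: power2_eq_square)
  have "(\<Sum>v\<in>Basis. \<integral>w. (v \<bullet> X w)\<^sup>2 * (z \<bullet> X w) ^ (2 * k) \<partial>M)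
      = (\<integral>w. (\<Sum>v\<in>Basis. (v \<bullet> X w)\<^sup>2 * (z \<bullet> X w) ^ (2 * k)) \<partial>M)"
    by (subst Bochner_Integration.integral_sum) simp_all
  also have "\<dots> = (\<integral>w. (z \<bullet> X w) ^ (2 * k) \<partial>M)"
  proof (rule integral_cong_AE)
    show "AE w in M. (\<Sum>v\<in>Basis. (v \<bullet> X w)\<^sup>2 * (z \<bullet> X w) ^ (2 * k)) = (z \<bullet> X w) ^ (2 * k)"
      using AE_norm_X
    proof eventually_elim
      case (elim w)
      then show ?case
        using parseval[of "X w"] by (simp add: sum_distrib_right[symmetric] inner_commute)
    qed
  qed measurable
  finally have average: "(\<Sum>v\<in>Basis. \<integral>w. (v \<bullet> X w)\<^sup>2 * (z \<bullet> X w) ^ (2 * k) \<partial>M)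
      = (\<integral>w. (z \<bullet> X w) ^ (2 * k) \<partial>M)" .
  have "real (Suc k * (2 * k + 1)) * (\<integral>w. (z \<bullet> X w) ^ (2 * k) \<partial>M)
      = (\<Sum>v\<in>Basis. real (Suc k * (2 * k + 1)) * (\<integral>w. (v \<bullet> X w)\<^sup>2 * (z \<bullet> X w) ^ (2 * k) \<partial>M))"
    by (simp only: average[symmetric] sum_distrib_left)
  also have "\<dots> = (\<Sum>v\<in>Basis. A * real (Suc k) * (1 + 2 * real k * (z \<bullet> v)\<^sup>2))"
    by (rule sum.cong[OF refl second_coeff])
  also have "\<dots> = A * real (Suc k) * (real DIM('a) + 2 * real k)"
    using parseval[of z] z by (simp add: sum_distrib_left[symmetric] sum.distrib)
  finally have "real (Suc k) * (real (2 * k + 1) * (\<integral>w. (z \<bullet> X w) ^ (2 * k) \<partial>M))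
      = real (Suc k) * (A * real (DIM('a) + 2 * k))"
    by (simp add: algebra_simps)
  then show ?thesis
    by (rule mult_left_cancel[THEN iffD1, rotated]) (rule of_nat_neq_0)
qed

text \<open>Descending with \<open>moment_laplacian\<close>, every lower even moment is constant on the sphere too, and all
  the constants are determined by the one of exponent 0, which is the total mass.\<close>

lemma moment_eq_sphere_moment:
  assumes "\<And>z. norm z = 1 \<Longrightarrow> (\<integral>w. (z \<bullet> X w) ^ (2 * k) \<partial>M) = A"
    and "j \<le> k" and "norm z = 1"
  shows "(\<integral>w. (z \<bullet> X w) ^ (2 * j) \<partial>M) = measure M (space M) * sphere_moment DIM('a) j"
  using assms
proof (induction k arbitrary: A j z)
  case 0
  then show ?case by (simp add: sphere_moment_def)
next
  case (Suc k)
  let ?A' = "A * real (DIM('a) + 2 * k) / real (2 * k + 1)"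
  have step: "(\<integral>w. (z \<bullet> X w) ^ (2 * k) \<partial>M) = ?A'" if "norm z = 1" for z
    using moment_laplacian[OF Suc.prems(1) that] by (simp add: field_simps)
  note lower = Suc.IH[OF step]
  show ?case
  proof (cases "j \<le> k")
    case True
    then show ?thesis using lower Suc.prems by blast
  next
    case False
    then have j: "j = Suc k" using Suc.prems by simp
    have mass: "?A' = measure M (space M) * sphere_moment DIM('a) k"
      using step[OF Suc.prems(3)] lower[OF _ order_refl Suc.prems(3)] by simp
    have dim_neq: "real (DIM('a) + 2 * k) \<noteq> 0"
      unfolding of_nat_eq_0_iff using DIM_positive[where 'a='a] by linarith
    have solve: "x = c * e / d" if "x * d / e = c" "d \<noteq> 0" "e \<noteq> 0" for x c d e :: real
      using that by (auto simp: field_simps)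
    have "A = measure M (space M) * sphere_moment DIM('a) k * real (2 * k + 1) / real (DIM('a) + 2 * k)"
      by (rule solve[OF mass dim_neq]) (unfold of_nat_eq_0_iff, simp)
    then show ?thesis
      using Suc.prems(1)[OF Suc.prems(3)] j by (simp add: sphere_moment_def)
  qed
qed

text \<open>The functions \<open>\<tau> g\<close> in the proof are the coordinates of the tensor power \<open>x\<^sup>\<otimes>\<^sup>m\<close>, whose inner product with
  \<open>y\<^sup>\<otimes>\<^sup>m\<close> is \<open>(x \<bullet> y) ^ m\<close>. The hypotheses make the squared distance between \<open>\<Sum>y\<in>C. y\<^sup>\<otimes>\<^sup>m\<close> and
  \<open>card C\<close> times the mean tensor of \<open>X\<close> equal to 0.\<close>

lemma tensor_moment_identity:
  fixes C :: "'a set"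
  assumes const: "\<And>z. norm z = 1 \<Longrightarrow> (\<integral>w. (z \<bullet> X w) ^ m \<partial>M) = c"
    and mass: "measure M (space M) = 1"
    and C: "finite C" "C \<subseteq> sphere 0 1"
    and energy: "(\<Sum>x\<in>C. \<Sum>y\<in>C. (x \<bullet> y) ^ m) = c * (real (card C))\<^sup>2"
    and z: "norm z = 1"
  shows "(\<Sum>y\<in>C. (z \<bullet> y) ^ m) = c * real (card C)"
proof -
  define G :: "(nat \<Rightarrow> 'a) set" where "G = PiE {..<m} (\<lambda>_. Basis)"
  define \<tau> where "\<tau> g x = (\<Prod>i<m. x \<bullet> g i)" for g :: "nat \<Rightarrow> 'a" and x
  have finG: "finite G" by (simp add: G_def finite_PiE)
  have tensor: "(x \<bullet> y) ^ m = (\<Sum>g\<in>G. \<tau> g x * \<tau> g y)" for x y :: 'a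
  proof -
    have "(x \<bullet> y) ^ m = (\<Prod>i<m. \<Sum>b\<in>Basis. (x \<bullet> b) * (y \<bullet> b))"
      by (subst euclidean_inner) simp
    also have "\<dots> = (\<Sum>g\<in>G. \<Prod>i<m. (x \<bullet> g i) * (y \<bullet> g i))"
      unfolding G_def by (rule prod_sum_PiE) auto
    finally show ?thesis by (simp add: \<tau>_def prod.distrib)
  qed
  define E where "E g = (\<integral>w. \<tau> g (X w) \<partial>M)" for g
  have meas [measurable]: "(\<lambda>w. \<tau> g (X w)) \<in> borel_measurable M" for g
    unfolding \<tau>_def by measurable
  have int [simp]: "integrable M (\<lambda>w. \<tau> g (X w))" if "g \<in> G" for g
  proof (rule integrable_const_bound[where B = 1])
    show "AE w in M. norm (\<tau> g (X w)) \<le> 1"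
      using AE_norm_X
    proof eventually_elim
      case (elim w)
      have "\<bar>X w \<bullet> g i\<bar> \<le> 1" if "i < m" for i
      proof -
        have "g i \<in> Basis"
          using PiE_mem[of g "{..<m}" "\<lambda>_. Basis" i] \<open>g \<in> G\<close> that by (simp add: G_def)
        then show ?thesis
          using Cauchy_Schwarz_ineq2[of "X w" "g i"] elim by simp
      qed
      then show ?case
        by (auto simp: \<tau>_def abs_prod intro!: prod_le_1)
    qed
  qed measurable
  have mean: "(\<Sum>g\<in>G. \<tau> g x * E g) = c" if "norm x = 1" for x
  proof -
    have "c = (\<integral>w. (\<Sum>g\<in>G. \<tau> g x * \<tau> g (X w)) \<partial>M)"
      using const[OF that] by (simp add: tensor)
    also have "\<dots> = (\<Sum>g\<in>G. \<tau> g x * E g)"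
      by (subst Bochner_Integration.integral_sum) (simp_all add: E_def)
    finally show ?thesis by simp
  qed
  have "(\<Sum>g\<in>G. (E g)\<^sup>2) = (\<integral>w. (\<Sum>g\<in>G. \<tau> g (X w) * E g) \<partial>M)"
    by (subst Bochner_Integration.integral_sum) (simp_all add: E_def power2_eq_square)
  also have "\<dots> = (\<integral>w. c \<partial>M)"
  proof (rule integral_cong_AE)
    show "AE w in M. (\<Sum>g\<in>G. \<tau> g (X w) * E g) = c"
      using AE_norm_X by eventually_elim (rule mean)
  qed measurable
  finally have energy_E: "(\<Sum>g\<in>G. (E g)\<^sup>2) = c" by (simp add: mass)
  have unit: "norm y = 1" if "y \<in> C" for y using C that by auto
  define T where "T g = (\<Sum>y\<in>C. \<tau> g y)" for g
  define N where "N = real (card C)"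
  have TT: "(\<Sum>g\<in>G. (T g)\<^sup>2) = c * N\<^sup>2"
  proof -
    have "(\<Sum>g\<in>G. (T g)\<^sup>2) = (\<Sum>g\<in>G. \<Sum>x\<in>C. \<Sum>y\<in>C. \<tau> g x * \<tau> g y)"
      by (simp add: T_def power2_eq_square sum_product)
    also have "\<dots> = (\<Sum>x\<in>C. \<Sum>g\<in>G. \<Sum>y\<in>C. \<tau> g x * \<tau> g y)"
      by (rule sum.swap)
    also have "\<dots> = (\<Sum>x\<in>C. \<Sum>y\<in>C. \<Sum>g\<in>G. \<tau> g x * \<tau> g y)"
      by (intro sum.cong refl sum.swap)
    finally show ?thesis using energy by (simp add: tensor N_def)
  qed
  have TE: "(\<Sum>g\<in>G. T g * E g) = c * N"
  proof -
    have "(\<Sum>g\<in>G. T g * E g) = (\<Sum>g\<in>G. \<Sum>y\<in>C. \<tau> g y * E g)"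
      by (simp add: T_def sum_distrib_right)
    also have "\<dots> = (\<Sum>y\<in>C. \<Sum>g\<in>G. \<tau> g y * E g)"
      by (rule sum.swap)
    also have "\<dots> = c * N" by (simp add: mean unit N_def)
    finally show ?thesis .
  qed
  have "(\<Sum>g\<in>G. (T g - N * E g)\<^sup>2)
      = (\<Sum>g\<in>G. (T g)\<^sup>2) - 2 * N * (\<Sum>g\<in>G. T g * E g) + N\<^sup>2 * (\<Sum>g\<in>G. (E g)\<^sup>2)"
    by (simp add: power2_diff sum.distrib sum_subtractf sum_distrib_left power_mult_distrib mult_ac)
  also have "\<dots> = 0"
    by (simp only: TT TE energy_E) (simp add: power2_eq_square algebra_simps)
  finally have T: "T g = N * E g" if "g \<in> G" for g
    using finG that by (simp add: sum_nonneg_eq_0_iff)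
  have "(\<Sum>y\<in>C. (z \<bullet> y) ^ m) = (\<Sum>y\<in>C. \<Sum>g\<in>G. \<tau> g z * \<tau> g y)"
    by (simp add: tensor)
  also have "\<dots> = (\<Sum>g\<in>G. \<tau> g z * T g)"
    by (subst sum.swap) (simp add: T_def sum_distrib_left)
  also have "\<dots> = (\<Sum>g\<in>G. N * (\<tau> g z * E g))"
    by (simp add: T mult_ac)
  also have "\<dots> = c * N"
    by (simp add: sum_distrib_left[symmetric] mean z)
  finally show ?thesis by (simp add: N_def)
qed

end

section \<open>The uniform distribution on the sphere\<close>

text \<open>The surface measure is the image of this distribution under \<open>sgn\<close>. Working with the distribution
  itself reduces statements about the sphere to Lebesgue measure.\<close>

abbreviation unit_ball_uniform :: "'a::euclidean_space measure" where
  "unit_ball_uniform \<equiv> uniform_measure lborel (ball 0 1)"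

lemma sgn_borel_measurable [measurable]:
  "(sgn :: 'a::euclidean_space \<Rightarrow> 'a) \<in> borel_measurable borel"
  unfolding sgn_div_norm[abs_def] by measurable

lemma AE_unit_ball_iff:
  "(AE x in unit_ball_uniform. P x) \<longleftrightarrow> (AE x in lborel. x \<in> ball (0::'a::euclidean_space) 1 \<longrightarrow> P x)"
  by (rule AE_uniform_measure) (fact emeasure_unit_ball)+

lemma unit_ball_uniform_mass:
  "measure unit_ball_uniform (space (unit_ball_uniform :: 'a::euclidean_space measure)) = 1"
  using emeasure_unit_ball[where 'a = 'a]
  by (simp add: measure_def divide_ennreal_def[symmetric] less_top[symmetric])

interpretation unit_ball: sphere_vector "unit_ball_uniform :: 'a::euclidean_space measure" sgn
proof (intro sphere_vector.intro finite_measureI sphere_vector_axioms.intro)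
  show "emeasure unit_ball_uniform (space (unit_ball_uniform :: 'a measure)) \<noteq> \<infinity>"
    using emeasure_unit_ball[where 'a = 'a]
    by (simp add: divide_ennreal_def ennreal_mult_eq_top_iff)
  show "AE w in unit_ball_uniform. norm (sgn w :: 'a) = 1"
    unfolding AE_unit_ball_iff using AE_lborel_singleton[of "0::'a"]
    by eventually_elim (simp add: norm_sgn)
qed simp

lemma sgn_orthogonal:
  "orthogonal_transformation f \<Longrightarrow> sgn (f w) = f (sgn w)"
  by (simp add: sgn_div_norm orthogonal_transformation_norm orthogonal_transformation_scaleR)

lemma distr_unit_ball_orthogonal:
  fixes f :: "'a::euclidean_space \<Rightarrow> 'a"
  assumes f: "orthogonal_transformation f"
  shows "distr unit_ball_uniform borel f = unit_ball_uniform"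
proof (rule measure_eqI)
  fix A assume "A \<in> sets (distr unit_ball_uniform borel f)"
  then have A [measurable]: "A \<in> sets borel" by simp
  note borel_measurable_orthogonal[OF f, measurable]
  have pre: "f -` A \<in> sets borel"
    using measurable_sets_borel[OF _ A, of f] by simp
  have "f -` (ball 0 1 \<inter> A) = ball 0 1 \<inter> f -` A"
    using f by (auto simp: orthogonal_transformation_norm)
  then show "emeasure (distr unit_ball_uniform borel f) A = emeasure unit_ball_uniform A"
    using emeasure_vimage_orthogonal[OF f, of "ball 0 1 \<inter> A"] pre
    by (simp add: emeasure_distr)
qed simp

lemma unit_ball_moment_const:
  fixes y z :: "real ^ 'n"
  assumes "norm y = 1" "norm z = 1"
  shows "(\<integral>w. (y \<bullet> sgn w) ^ m \<partial>unit_ball_uniform) = (\<integral>w. (z \<bullet> sgn w) ^ m \<partial>unit_ball_uniform)"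
proof -
  obtain f where f: "orthogonal_transformation f" "f y = z"
    using orthogonal_transformation_exists[of y z] assms by auto
  note borel_measurable_orthogonal[OF f(1), measurable]
  have "(\<integral>w. (z \<bullet> sgn w) ^ m \<partial>unit_ball_uniform) = (\<integral>w. (z \<bullet> sgn w) ^ m \<partial>distr unit_ball_uniform borel f)"
    by (simp only: distr_unit_ball_orthogonal[OF f(1)])
  also have "\<dots> = (\<integral>w. (f y \<bullet> f (sgn w)) ^ m \<partial>unit_ball_uniform)"
    by (subst integral_distr) (simp_all add: sgn_orthogonal f)
  also have "\<dots> = (\<integral>w. (y \<bullet> sgn w) ^ m \<partial>unit_ball_uniform)"
    using f(1) by (simp add: orthogonal_transformation_def)
  finally show ?thesis by simp
qed

lemma unit_ball_moment:
  fixes z :: "real ^ 'n"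
  assumes "norm z = 1"
  shows "(\<integral>w. (z \<bullet> sgn w) ^ (2 * k) \<partial>unit_ball_uniform) = sphere_moment CARD('n) k"
  using unit_ball.moment_eq_sphere_moment[OF unit_ball_moment_const[OF _ assms] order_refl assms]
    unit_ball_uniform_mass[where 'a = "real ^ 'n"]
  by simp

text \<open>The surface measure charges every open subset of the sphere: \<open>w \<mapsto> g (sgn w)\<close> vanishes almost everywhere
  on the punctured unit ball and is continuous there, so it vanishes at all points, in particular
  at \<open>x / 2\<close>.\<close>

lemma zero_on_sphere_if_zero_mean:
  fixes g :: "'a::euclidean_space \<Rightarrow> real"
  assumes cont: "continuous_on (sphere 0 1) g"
    and nonneg: "\<And>x. norm x = 1 \<Longrightarrow> g x \<ge> 0"
    and int: "integrable unit_ball_uniform (\<lambda>w. g (sgn w))"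
    and zero: "(\<integral>w. g (sgn w) \<partial>unit_ball_uniform) = 0"
    and x: "norm x = 1"
  shows "g x = 0"
proof -
  have "AE w in unit_ball_uniform. 0 \<le> g (sgn w)"
    using unit_ball.AE_norm_X by eventually_elim (rule nonneg)
  then have "AE w in unit_ball_uniform. g (sgn w) = 0"
    using integral_nonneg_eq_0_iff_AE[OF int] zero by simp
  then have "AE w in lborel. w \<in> ball 0 1 \<longrightarrow> g (sgn w) = 0"
    by (simp only: AE_unit_ball_iff)
  then have ae: "AE w in lebesgue. w \<in> ball 0 1 \<longrightarrow> g (sgn w) = 0"
    by (rule AE_completion)
  let ?S = "ball (0::'a) 1 - {0}"
  have "continuous_on ?S (\<lambda>w. g (sgn w))"
    by (rule continuous_on_compose2[OF cont])
       (auto intro!: continuous_on_sgn continuous_intros simp: norm_sgn split: if_splits)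
  then have "open (?S \<inter> (\<lambda>w. g (sgn w)) -` (- {0}))"
    by (rule continuous_open_preimage) auto
  then have cl: "closed (- (?S \<inter> (\<lambda>w. g (sgn w)) -` (- {0})))"
    by (rule closed_Compl)
  have ae': "AE w \<in> ?S in lebesgue. w \<in> - (?S \<inter> (\<lambda>w. g (sgn w)) -` (- {0}))"
    using ae by eventually_elim auto
  have half: "(1/2) *\<^sub>R x \<in> ?S" using x by auto
  have "open ?S" by (intro open_delete open_ball)
  then have "(1/2) *\<^sub>R x \<in> - (?S \<inter> (\<lambda>w. g (sgn w)) -` (- {0}))"
    by (rule mem_closed_if_AE_lebesgue_open[OF _ cl ae' half])
  then have "g (sgn ((1/2) *\<^sub>R x)) = 0" using half by blast
  moreover have "sgn x = x" using x by (simp add: sgn_div_norm)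
  ultimately show ?thesis by (simp add: sgn_scaleR)
qed

lemma lower_bound_le_mean:
  fixes g :: "'a::euclidean_space \<Rightarrow> real"
  assumes cont: "continuous_on (sphere 0 1) g"
    and int: "integrable unit_ball_uniform (\<lambda>w. g (sgn w))"
    and a: "\<And>x. norm x = 1 \<Longrightarrow> a \<le> g x"
  shows "a \<le> (\<integral>w. g (sgn w) \<partial>unit_ball_uniform)"
    and "a = (\<integral>w. g (sgn w) \<partial>unit_ball_uniform) \<Longrightarrow> norm x = 1 \<Longrightarrow> g x = a"
proof -
  have mean: "(\<integral>w. g (sgn w) - a \<partial>unit_ball_uniform) = (\<integral>w. g (sgn w) \<partial>unit_ball_uniform) - a"
    using int unit_ball_uniform_mass[where 'a = 'a] by simp
  have "AE w in unit_ball_uniform. 0 \<le> g (sgn w) - a"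
    using unit_ball.AE_norm_X by eventually_elim (simp add: a)
  then have "0 \<le> (\<integral>w. g (sgn w) - a \<partial>unit_ball_uniform)"
    by (rule integral_nonneg_AE)
  then show "a \<le> (\<integral>w. g (sgn w) \<partial>unit_ball_uniform)" by (simp only: mean diff_ge_0_iff_ge)
  assume eq: "a = (\<integral>w. g (sgn w) \<partial>unit_ball_uniform)" and x: "norm x = 1"
  have "g x - a = 0"
  proof (rule zero_on_sphere_if_zero_mean[where g = "\<lambda>x. g x - a"])
    show "(\<integral>w. g (sgn w) - a \<partial>unit_ball_uniform) = 0" unfolding mean by (simp flip: eq)
  qed (use cont int a x in \<open>auto intro!: continuous_intros\<close>)
  then show "g x = a" by simp
qed

lemma integral_sphere_measure:
  fixes g :: "real ^ 'n \<Rightarrow> real"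
  assumes "g \<in> borel_measurable borel"
  shows "integral\<^sup>L sphere_measure g = (\<integral>w. g (sgn w) \<partial>unit_ball_uniform)"
  unfolding sphere_measure_def using assms by (subst integral_distr) simp_all

section \<open>The Gegenbauer weight\<close>

definition gweight :: "nat \<Rightarrow> real \<Rightarrow> real" where
  "gweight n t = (1 - t\<^sup>2) powr ((real n - 3) / 2)"

definition weight_integral :: "nat \<Rightarrow> real poly \<Rightarrow> real" where
  "weight_integral n p = integral {-1..1} (\<lambda>t. poly p t * gweight n t)"

text \<open>This is the weight for \<open>n = 2\<close>, which is unbounded at the endpoints and dominates the weights for
  all larger \<open>n\<close>.\<close>

lemma integrable_arcsin_deriv: "(\<lambda>t::real. inverse (sqrt (1 - t\<^sup>2))) integrable_on {-1..1}"
proof -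
  have "((\<lambda>t::real. inverse (sqrt (1 - t\<^sup>2))) has_integral (arcsin 1 - arcsin (-1))) {-1..1}"
    by (rule fundamental_theorem_of_calculus_interior)
       (auto intro: continuous_on_arcsin' DERIV_arcsin simp: has_real_derivative_iff_has_vector_derivative[symmetric])
  then show ?thesis by blast
qed

lemma gweight_le:
  assumes "n \<ge> 2" "t \<in> {-1..1}"
  shows "gweight n t \<le> inverse (sqrt (1 - t\<^sup>2))"
proof (cases "t\<^sup>2 = 1")
  case False
  have "t\<^sup>2 \<le> 1" using assms by (simp add: abs_square_le_1 abs_le_iff)
  with False have t: "0 < 1 - t\<^sup>2" "1 - t\<^sup>2 \<le> 1" by auto
  have "gweight n t \<le> (1 - t\<^sup>2) powr (- (1/2))"
    unfolding gweight_def by (rule powr_mono') (use t assms in auto)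
  also have "\<dots> = inverse (sqrt (1 - t\<^sup>2))"
    using t by (simp add: powr_minus powr_half_sqrt)
  finally show ?thesis .
qed (simp add: gweight_def)

lemma gweight_nonneg: "gweight n t \<ge> 0"
  by (simp add: gweight_def)

lemma integrable_power_gweight:
  assumes "n \<ge> 2"
  shows "(\<lambda>t. t ^ j * gweight n t) integrable_on {-1..1}"
proof (rule measurable_bounded_by_integrable_imp_integrable[OF _ integrable_arcsin_deriv])
  have "(\<lambda>t. t ^ j * gweight n t) \<in> borel_measurable borel"
    unfolding gweight_def by measurable
  then show "(\<lambda>t. t ^ j * gweight n t) \<in> borel_measurable (lebesgue_on {-1..1})"
    by (intro measurable_restrict_space1 measurable_completion) simp
next
  fix t :: real assume t: "t \<in> {-1..1}"
  then have "\<bar>t\<bar> ^ j \<le> 1" by (intro power_le_one) auto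
  then have "\<bar>t\<bar> ^ j * gweight n t \<le> 1 * inverse (sqrt (1 - t\<^sup>2))"
    using gweight_le[OF assms t] by (intro mult_mono) (auto simp: gweight_nonneg)
  then show "norm (t ^ j * gweight n t) \<le> inverse (sqrt (1 - t\<^sup>2))"
    by (simp add: abs_mult power_abs gweight_nonneg)
qed auto

lemma integrable_poly_gweight:
  assumes "n \<ge> 2"
  shows "(\<lambda>t. poly p t * gweight n t) integrable_on {-1..1}"
proof -
  have "(\<lambda>t. \<Sum>i\<le>degree p. coeff p i * (t ^ i * gweight n t)) integrable_on {-1..1}"
    by (intro integrable_sum integrable_on_mult_right integrable_power_gweight assms) auto
  then show ?thesis
    by (simp add: poly_altdef sum_distrib_right mult.assoc)
qed

lemma
  assumes "n \<ge> 2"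
  shows weight_integral_add: "weight_integral n (p + q) = weight_integral n p + weight_integral n q"
    and weight_integral_diff: "weight_integral n (p - q) = weight_integral n p - weight_integral n q"
    and weight_integral_smult: "weight_integral n (smult c p) = c * weight_integral n p"
  unfolding weight_integral_def
  using integral_add[OF integrable_poly_gweight[OF assms] integrable_poly_gweight[OF assms], of p q]
    integral_diff[OF integrable_poly_gweight[OF assms] integrable_poly_gweight[OF assms], of p q]
    integral_mult_right[of "{-1..1}" c "\<lambda>t. poly p t * gweight n t"]
  by (simp_all add: ring_distribs mult.assoc)

lemma weight_integral_0 [simp]: "weight_integral n 0 = 0"
  by (simp add: weight_integral_def)

lemma weight_integral_sum: "n \<ge> 2 \<Longrightarrow> weight_integral n (\<Sum>i\<in>A. f i) = (\<Sum>i\<in>A. weight_integral n (f i))"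
  by (induction A rule: infinite_finite_induct) (simp_all add: weight_integral_add)

lemma weight_integral_mult_expand:
  assumes "n \<ge> 2"
  shows "weight_integral n (p * q) = (\<Sum>i\<le>degree p. coeff p i * weight_integral n (q * monom 1 i))"
proof -
  have "p * q = (\<Sum>i\<le>degree p. smult (coeff p i) (q * monom 1 i))"
  proof -
    have "monom c i * q = smult c (q * monom 1 i)" for c i
      by (simp add: mult.commute[of q] smult_monom flip: mult_smult_left)
    then show ?thesis
      using arg_cong[OF poly_as_sum_of_monoms[of p], of "\<lambda>r. r * q"] by (simp add: sum_distrib_right)
  qed
  then show ?thesis
    by (simp add: weight_integral_sum weight_integral_smult assms)
qed

text \<open>The integrand is the derivative of \<open>t ^ i * (1 - t\<^sup>2) powr ((n - 1) / 2)\<close>, which vanishes at both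
  endpoints. This identity yields the recursion for the moments of the weight.\<close>

lemma has_integral_gweight_by_parts:
  assumes "n \<ge> 2"
  shows "((\<lambda>t. (real i * t ^ (i - 1) * (1 - t\<^sup>2) - (real n - 1) * t ^ (i + 1)) * gweight n t)
           has_integral 0) {-1..1}"
proof -
  let ?F = "\<lambda>t::real. t ^ i * (1 - t\<^sup>2) powr ((real n - 1) / 2)"
  let ?f = "\<lambda>t::real. (real i * t ^ (i - 1) * (1 - t\<^sup>2) - (real n - 1) * t ^ (i + 1)) * gweight n t"
  have "(?f has_integral (?F 1 - ?F (-1))) {-1..1}"
  proof (rule fundamental_theorem_of_calculus_interior)
    show "continuous_on {-1..1} ?F"
      by (intro continuous_intros continuous_on_powr')
         (use assms in \<open>auto simp: abs_square_le_1 abs_le_iff\<close>)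
  next
    fix t :: real assume "t \<in> {-1<..<1}"
    then have t: "1 - t\<^sup>2 > 0" by (auto simp: abs_square_less_1)
    have split: "(1 - t\<^sup>2) powr ((real n - 1) / 2) = (1 - t\<^sup>2) * gweight n t"
    proof -
      have "(1 - t\<^sup>2) powr ((real n - 1) / 2) = (1 - t\<^sup>2) powr (1 + (real n - 3) / 2)"
        by (simp add: field_simps)
      then show ?thesis using t by (simp add: powr_add gweight_def)
    qed
    have exponent: "(real n - 1) / 2 - 1 = (real n - 3) / 2" by (simp add: field_simps)
    have "(?F has_real_derivative real i * t ^ (i - 1) * (1 - t\<^sup>2) powr ((real n - 1) / 2)
        + t ^ i * ((real n - 1) / 2 * (1 - t\<^sup>2) powr ((real n - 1) / 2 - 1) * (- 2 * t))) (at t)"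
      using t by (auto intro!: derivative_eq_intros simp: has_real_derivative_powr)
    also have "real i * t ^ (i - 1) * (1 - t\<^sup>2) powr ((real n - 1) / 2)
        + t ^ i * ((real n - 1) / 2 * (1 - t\<^sup>2) powr ((real n - 1) / 2 - 1) * (- 2 * t)) = ?f t"
      unfolding split exponent gweight_def[symmetric] by (simp add: field_simps)
    finally show "(?F has_vector_derivative ?f t) (at t)"
      by (simp add: has_real_derivative_iff_has_vector_derivative)
  qed simp
  then show ?thesis by simp
qed

lemma weight_integral_monom_odd_base: "n \<ge> 2 \<Longrightarrow> weight_integral n (monom 1 1) = 0"
  using has_integral_mult_right[OF has_integral_gweight_by_parts[of n 0], of "- 1 / (real n - 1)"]
  by (auto simp: weight_integral_def poly_monom intro!: integral_unique)

lemma weight_integral_monom_step: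
  assumes "n \<ge> 2"
  shows "real (n + j) * weight_integral n (monom 1 (j + 2)) = real (j + 1) * weight_integral n (monom 1 j)"
proof -
  have "weight_integral n (smult (real (j + 1)) (monom 1 j) - smult (real (n + j)) (monom 1 (j + 2))) = 0"
    unfolding weight_integral_def
    using has_integral_gweight_by_parts[OF assms, of "j + 1"]
    by (intro integral_unique) (simp add: poly_monom algebra_simps power2_eq_square)
  then show ?thesis
    by (simp add: weight_integral_diff weight_integral_smult assms)
qed

text \<open>On \<open>{-1/2..1/2}\<close> the base \<open>1 - t\<^sup>2\<close> lies between \<open>3/4\<close> and 1 and the exponent is less than \<open>n\<close>, so the
  weight is at least \<open>(3/4) ^ n\<close> there.\<close>

lemma weight_integral_1_pos:
  assumes "n \<ge> 2"
  shows "weight_integral n 1 > 0"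
proof -
  have "(\<lambda>t. 1 * gweight n t) integrable_on {-1..1}"
    using integrable_power_gweight[OF assms, of 0] by simp
  then have whole: "gweight n integrable_on {-1..1}" by simp
  then have half: "gweight n integrable_on {-(1/2)..1/2}"
    by (rule integrable_subinterval_real) auto
  have lower: "(3/4) ^ n \<le> gweight n t" if "t \<in> {-(1/2)..1/2}" for t :: real
  proof -
    have "\<bar>t\<bar> \<le> 1/2" using that by auto
    then have "t\<^sup>2 \<le> (1/2)\<^sup>2" by (metis abs_ge_zero power2_abs power_mono)
    then have t: "3/4 \<le> 1 - t\<^sup>2" "1 - t\<^sup>2 \<le> 1" by (auto simp: power2_eq_square)
    have "(3/4) ^ n \<le> (1 - t\<^sup>2) ^ n" using t by (intro power_mono) auto
    also have "\<dots> = (1 - t\<^sup>2) powr real n" using t by (simp add: powr_realpow)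
    also have "\<dots> \<le> gweight n t"
      unfolding gweight_def by (rule powr_mono') (use t in auto)
    finally show ?thesis .
  qed
  have "integral {-(1/2)..1/2} (\<lambda>_::real. (3/4) ^ n :: real) \<le> integral {-(1/2)..1/2} (gweight n)"
    by (rule integral_le) (use half lower in auto)
  also have "\<dots> \<le> integral {-1..1} (gweight n)"
    by (rule integral_subset_le) (use half whole in \<open>auto simp: gweight_nonneg\<close>)
  finally have "(3/4) ^ n \<le> weight_integral n 1" by (simp add: weight_integral_def)
  moreover have "(3/4 :: real) ^ n > 0" by simp
  ultimately show ?thesis by linarith
qed

section \<open>Gegenbauer polynomials\<close>

text \<open>The classical three-term recurrence. Degree 1 has its own clause because the general step from degree 0
  to degree 1 would divide by \<open>n - 2\<close>, which is 0 on the circle.\<close>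

fun gegenbauer_rec :: "nat \<Rightarrow> nat \<Rightarrow> real poly" where
  "gegenbauer_rec n 0 = 1"
| "gegenbauer_rec n (Suc 0) = [:0, 1:]"
| "gegenbauer_rec n (Suc (Suc l)) = smult (1 / (real l + real n - 1))
     (smult (2 * real l + real n) (pCons 0 (gegenbauer_rec n (Suc l))) - smult (real l + 1) (gegenbauer_rec n l))"

text \<open>The integral of \<open>t ^ j\<close> against the Gegenbauer polynomial of degree \<open>l\<close>, divided by the total weight
  (see \<open>weight_integral_gegenbauer_rec_monom\<close>). With \<open>j = l + 2 * s\<close> it is
  \<open>j! / (2\<^sup>s s! n (n + 2) \<dots> (n + 2 (l + s) - 2))\<close>, which Rodrigues' formula would give.\<close>

definition gegenbauer_moment :: "nat \<Rightarrow> nat \<Rightarrow> nat \<Rightarrow> real" where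
  "gegenbauer_moment n l j = (if j < l \<or> odd (l + j) then 0
     else fact j / (2 ^ ((j - l) div 2) * fact ((j - l) div 2) * (\<Prod>i<(l + j) div 2. real (n + 2 * i))))"

lemma gegenbauer_moment_zero: "j < l \<or> odd (l + j) \<Longrightarrow> gegenbauer_moment n l j = 0"
  by (auto simp: gegenbauer_moment_def)

lemma gegenbauer_moment_formula:
  "gegenbauer_moment n l (l + 2 * s) = fact (l + 2 * s) / (2 ^ s * fact s * (\<Prod>i<l + s. real (n + 2 * i)))"
proof -
  have "(l + (l + 2 * s)) div 2 = l + s" by simp
  then show ?thesis by (simp add: gegenbauer_moment_def)
qed

text \<open>The closed form obeys the recurrence of the polynomials, one exponent of \<open>t\<close> being shifted because of the
  factor \<open>t\<close>. For \<open>j = l\<close> the two terms on the right cancel, which makes the polynomial of degree \<open>l + 2\<close>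
  orthogonal to \<open>t ^ l\<close>.\<close>

lemma gegenbauer_moment_rec:
  assumes "n \<ge> 2"
  shows "(real l + real n - 1) * gegenbauer_moment n (Suc (Suc l)) j
       = (2 * real l + real n) * gegenbauer_moment n (Suc l) (Suc j) - (real l + 1) * gegenbauer_moment n l j"
proof (cases "j < l \<or> odd (l + j)")
  case True
  then have "gegenbauer_moment n (Suc (Suc l)) j = 0" "gegenbauer_moment n (Suc l) (Suc j) = 0" "gegenbauer_moment n l j = 0"
    by (auto intro!: gegenbauer_moment_zero)
  then show ?thesis by simp
next
  case False
  then have "even (j - l)" "l \<le> j" by auto
  then obtain s where s: "j = l + 2 * s" by (metis dvdE le_add_diff_inverse)
  define D where "D k = (\<Prod>i<k. real (n + 2 * i))" for k
  have D: "D k > 0" for k unfolding D_def using assms by (intro prod_pos) auto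
  have D_Suc: "D (Suc k) = D k * (real n + 2 * real k)" for k by (simp add: D_def)
  show ?thesis
  proof (cases s)
    case 0
    have "gegenbauer_moment n (Suc (Suc l)) j = 0" by (rule gegenbauer_moment_zero) (simp add: s 0)
    moreover have "gegenbauer_moment n (Suc l) (Suc j) = (real l + 1) * fact l / (D l * (real n + 2 * real l))"
      using gegenbauer_moment_formula[of n "Suc l" 0] by (simp add: s 0 D_def algebra_simps)
    moreover have "gegenbauer_moment n l j = fact l / D l"
      using gegenbauer_moment_formula[of n l 0] by (simp add: s 0 D_def)
    moreover have "real n + 2 * real l \<noteq> 0" "D l \<noteq> 0" using assms D[of l] by auto
    ultimately show ?thesis by (simp add: add.commute[of _ "real n"])
  next
    case (Suc r)
    have 1: "gegenbauer_moment n (Suc (Suc l)) j = fact j / (2 ^ r * fact r * D (Suc (Suc (l + r))))"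
      using gegenbauer_moment_formula[of n "Suc (Suc l)" r] by (simp add: s Suc D_def)
    have 2: "gegenbauer_moment n (Suc l) (Suc j)
        = (real j + 1) * fact j / (2 * 2 ^ r * ((real r + 1) * fact r) * D (Suc (Suc (l + r))))"
      using gegenbauer_moment_formula[of n "Suc l" "Suc r"] by (simp add: s Suc D_def algebra_simps)
    have 3: "gegenbauer_moment n l j = fact j / (2 * 2 ^ r * ((real r + 1) * fact r) * D (Suc (l + r)))"
      using gegenbauer_moment_formula[of n l "Suc r"] by (simp add: s Suc D_def algebra_simps)
    \<comment> \<open>the common factor of the three terms; what remains is a polynomial identity\<close>
    define c where "c = fact j / (2 * 2 ^ r * ((real r + 1) * fact r) * D (Suc (Suc (l + r))))"
    have nz: "D (Suc (l + r)) \<noteq> 0" "real n + 2 * real (Suc (l + r)) \<noteq> 0" "real r + 1 \<noteq> 0"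
      using D[of "Suc (l + r)"] by auto
    have "gegenbauer_moment n (Suc (Suc l)) j = c * (2 * (real r + 1))"
      using nz unfolding 1 c_def by (simp add: divide_simps)
    moreover have "gegenbauer_moment n (Suc l) (Suc j) = c * (real j + 1)"
      unfolding 2 c_def by simp
    moreover have "gegenbauer_moment n l j = c * (real n + 2 * real (Suc (l + r)))"
      using nz unfolding 3 c_def D_Suc[of "Suc (l + r)"] by (simp add: divide_simps)
    ultimately show ?thesis
      by (simp add: s Suc algebra_simps)
  qed
qed

lemma gegenbauer_moment_1: "gegenbauer_moment n (Suc 0) j = gegenbauer_moment n 0 (Suc j)"
proof (cases "odd j")
  case True
  then obtain r where r: "j = 2 * r + 1" by (metis oddE)
  have "gegenbauer_moment n 0 (Suc j) = (2 * (real r + 1)) * fact (2 * r + 1)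
      / ((2 * (real r + 1)) * (2 ^ r * fact r * (\<Prod>i<Suc r. real (n + 2 * i))))"
    using gegenbauer_moment_formula[of n 0 "Suc r"] by (simp add: r algebra_simps)
  also have "\<dots> = gegenbauer_moment n (Suc 0) j"
    unfolding r using gegenbauer_moment_formula[of n "Suc 0" r]
    by (subst mult_divide_mult_cancel_left) simp_all
  finally show ?thesis by simp
qed (auto simp: gegenbauer_moment_def)

lemma gegenbauer_moment_0_step:
  assumes "n \<ge> 2"
  shows "real (n + j) * gegenbauer_moment n 0 (Suc (Suc j)) = real (j + 1) * gegenbauer_moment n 0 j"
proof (cases "even j")
  case True
  then obtain r where r: "j = 2 * r" by blast
  define d where "d = 2 ^ r * fact r * (\<Prod>i<r. real (n + 2 * i))"
  have "gegenbauer_moment n 0 (Suc (Suc j))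
      = (2 * (real r + 1)) * ((2 * real r + 1) * fact j) / ((2 * (real r + 1)) * (d * real (n + j)))"
    using gegenbauer_moment_formula[of n 0 "Suc r"] by (simp add: r d_def algebra_simps)
  also have "\<dots> = (2 * real r + 1) * fact j / (d * real (n + j))"
    by (subst mult_divide_mult_cancel_left) simp_all
  finally show ?thesis
    using gegenbauer_moment_formula[of n 0 r] assms by (simp add: r d_def)
qed (simp add: gegenbauer_moment_zero)

lemma weight_integral_monom:
  assumes "n \<ge> 2"
  shows "weight_integral n (monom 1 j) = weight_integral n 1 * gegenbauer_moment n 0 j"
proof (induction j rule: induct_nat_012)
  case 0
  then show ?case by (simp add: gegenbauer_moment_def)
next
  case 1
  then show ?case using weight_integral_monom_odd_base[OF assms] by (simp add: gegenbauer_moment_def)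
next
  case (ge2 j)
  have "real (n + j) * (weight_integral n 1 * gegenbauer_moment n 0 (Suc (Suc j))) = real (n + j) * weight_integral n (monom 1 (Suc (Suc j)))"
    using weight_integral_monom_step[OF assms, of j] gegenbauer_moment_0_step[OF assms, of j] ge2(1)
    by (simp only: mult.left_commute[of _ "weight_integral n 1"]) simp
  then show ?case using assms by simp
qed

lemma weight_integral_gegenbauer_rec_monom:
  assumes "n \<ge> 2"
  shows "weight_integral n (gegenbauer_rec n l * monom 1 j) = weight_integral n 1 * gegenbauer_moment n l j"
proof (induction l arbitrary: j rule: induct_nat_012)
  case 0
  then show ?case by (simp add: weight_integral_monom assms)
next
  case 1
  have "[:0, 1:] * monom (1::real) j = monom 1 (Suc j)" by (simp add: monom_Suc)
  then show ?case by (simp add: weight_integral_monom assms gegenbauer_moment_1)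
next
  case (ge2 l)
  have "gegenbauer_rec n (Suc (Suc l)) * monom 1 j = smult (1 / (real l + real n - 1))
      (smult (2 * real l + real n) (gegenbauer_rec n (Suc l) * monom 1 (Suc j))
        - smult (real l + 1) (gegenbauer_rec n l * monom 1 j))"
    by (simp add: left_diff_distrib monom_Suc)
  then have "weight_integral n (gegenbauer_rec n (Suc (Suc l)) * monom 1 j)
      = weight_integral n 1 * (1 / (real l + real n - 1) * ((real l + real n - 1) * gegenbauer_moment n (Suc (Suc l)) j))"
    using assms by (simp only: weight_integral_smult weight_integral_diff ge2 gegenbauer_moment_rec) (simp add: algebra_simps)
  then show ?case using assms by simp
qed

lemma coeff_gegenbauer_rec_parity: "odd (l + i) \<Longrightarrow> coeff (gegenbauer_rec n l) i = 0"
proof (induction n l arbitrary: i rule: gegenbauer_rec.induct)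
  case (1 n)
  then show ?case by (cases i) auto
next
  case (2 n)
  then show ?case by (auto simp: coeff_pCons split: nat.splits)
next
  case (3 n l)
  then show ?case by (auto simp: coeff_pCons split: nat.splits)
qed

lemma degree_gegenbauer_rec_le: "degree (gegenbauer_rec n l) \<le> l"
proof (induction n l rule: gegenbauer_rec.induct)
  case (3 n l)
  have "degree (pCons 0 (gegenbauer_rec n (Suc l))) \<le> Suc (Suc l)"
    using 3 by (auto simp: degree_pCons_eq_if)
  then show ?case
    using 3 by (auto intro!: degree_diff_le order.trans[OF degree_smult_le])
qed auto

lemma lead_coeff_gegenbauer_rec_pos: "n \<ge> 2 \<Longrightarrow> coeff (gegenbauer_rec n l) l > 0"
proof (induction n l rule: gegenbauer_rec.induct)
  case (3 n l)
  have "coeff (gegenbauer_rec n l) (Suc (Suc l)) = 0"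
    using degree_gegenbauer_rec_le[of n l] by (intro coeff_eq_0) simp
  then show ?case using 3 by simp
qed auto

lemma degree_gegenbauer_rec: "n \<ge> 2 \<Longrightarrow> degree (gegenbauer_rec n l) = l"
  using degree_gegenbauer_rec_le[of n l] lead_coeff_gegenbauer_rec_pos[of n l] le_degree[of "gegenbauer_rec n l" l] by simp

lemma poly_gegenbauer_rec_1: "n \<ge> 2 \<Longrightarrow> poly (gegenbauer_rec n l) 1 = 1"
proof (induction n l rule: gegenbauer_rec.induct)
  case (3 n l)
  have "poly (gegenbauer_rec n (Suc (Suc l))) 1 = (real l + real n - 1) / (real l + real n - 1)"
    using 3 by simp
  then show ?case using 3(3) by simp
qed auto

lemma gegenbauer_rec_orthogonal:
  assumes "n \<ge> 2" "i \<noteq> j"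
  shows "weight_integral n (gegenbauer_rec n i * gegenbauer_rec n j) = 0"
proof -
  have "weight_integral n (gegenbauer_rec n i * gegenbauer_rec n j) = 0" if "i < j" for i j
    using that
    unfolding weight_integral_mult_expand[OF assms(1), of "gegenbauer_rec n i" "gegenbauer_rec n j"]
    by (simp add: weight_integral_gegenbauer_rec_monom gegenbauer_moment_zero degree_gegenbauer_rec assms(1))
  then show ?thesis
    using assms(2) by (metis mult.commute nat_neq_iff)
qed

lemma gegenbauer_rec_family: "n \<ge> 2 \<Longrightarrow> is_gegenbauer_family n (gegenbauer_rec n)"
  using gegenbauer_rec_orthogonal[of n]
  by (simp add: is_gegenbauer_family_def degree_gegenbauer_rec poly_gegenbauer_rec_1 weight_integral_def gweight_def)

text \<open>Subtract from \<open>P l\<close> the multiple of the recurrence polynomial that cancels the leading term. By induction the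
  difference \<open>D\<close> is orthogonal to the recurrence polynomial of its own degree. That integral
  equals the leading coefficient of \<open>D\<close> times a nonzero moment, so \<open>D = 0\<close>, and the
  normalization at 1 fixes the multiple.\<close>

lemma gegenbauer_family_unique:
  assumes n: "n \<ge> 2" and P: "is_gegenbauer_family n P"
  shows "P l = gegenbauer_rec n l"
proof (induction l rule: less_induct)
  case (less l)
  have deg: "degree (P i) = i" and one: "poly (P i) 1 = 1" for i
    using P by (auto simp: is_gegenbauer_family_def)
  have orth: "weight_integral n (P i * P j) = 0" if "i \<noteq> j" for i j
    using P that by (simp add: is_gegenbauer_family_def weight_integral_def gweight_def)
  define r where "r = lead_coeff (P l) / lead_coeff (gegenbauer_rec n l)"
  define D where "D = P l - smult r (gegenbauer_rec n l)"
  have "D = 0"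
  proof (rule ccontr)
    assume "D \<noteq> 0"
    have "degree D \<le> l"
      unfolding D_def using deg[of l] degree_gegenbauer_rec[OF n, of l]
      by (intro degree_diff_le order.trans[OF degree_smult_le]) auto
    moreover have "coeff D l = 0"
      using lead_coeff_gegenbauer_rec_pos[OF n, of l] by (simp add: D_def r_def deg degree_gegenbauer_rec n)
    ultimately have d: "degree D < l"
      using \<open>D \<noteq> 0\<close> eq_zero_or_degree_less by blast
    have "weight_integral n (D * gegenbauer_rec n (degree D))
        = weight_integral n (P l * P (degree D)) - r * weight_integral n (gegenbauer_rec n l * gegenbauer_rec n (degree D))"
      using less.IH[OF d] by (simp add: D_def left_diff_distrib weight_integral_diff weight_integral_smult n)
    also have "\<dots> = 0" using d by (simp add: orth gegenbauer_rec_orthogonal n)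
    finally have "(\<Sum>i\<le>degree D. coeff D i * (weight_integral n 1 * gegenbauer_moment n (degree D) i)) = 0"
      unfolding weight_integral_mult_expand[OF n, of D "gegenbauer_rec n (degree D)"] by (simp add: weight_integral_gegenbauer_rec_monom n)
    moreover have "(\<Sum>i\<le>degree D. coeff D i * (weight_integral n 1 * gegenbauer_moment n (degree D) i))
        = lead_coeff D * (weight_integral n 1 * gegenbauer_moment n (degree D) (degree D))"
      by (subst sum.remove[of _ "degree D"]) (auto simp: gegenbauer_moment_zero intro!: sum.neutral)
    moreover have "gegenbauer_moment n (degree D) (degree D) \<noteq> 0"
      using n by (simp add: gegenbauer_moment_def)
    ultimately show False
      using \<open>D \<noteq> 0\<close> weight_integral_1_pos[OF n] by simp
  qed
  then have eq: "P l = smult r (gegenbauer_rec n l)" by (simp add: D_def)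
  then have "r = 1" using one[of l] poly_gegenbauer_rec_1[OF n, of l] by simp
  then show ?case using eq by simp
qed

lemma gegenbauer_eq: "n \<ge> 2 \<Longrightarrow> gegenbauer n = gegenbauer_rec n"
  unfolding gegenbauer_def
  by (intro the_equality gegenbauer_rec_family ext gegenbauer_family_unique)

lemma gegenbauer_moment_0_even: "n \<ge> 2 \<Longrightarrow> gegenbauer_moment n 0 (2 * k) = sphere_moment n k"
proof -
  have "fact (2 * k) = (2 ^ k * fact k * (\<Prod>i<k. real (2 * i + 1)) :: real)"
    by (induction k) (simp_all add: algebra_simps)
  then show "n \<ge> 2 \<Longrightarrow> gegenbauer_moment n 0 (2 * k) = sphere_moment n k"
    using gegenbauer_moment_formula[of n 0 k] by (simp add: sphere_moment_def)
qed

lemma poly_gegenbauer_rec_even: "poly (gegenbauer_rec n (2 * j)) t = (\<Sum>i\<le>j. coeff (gegenbauer_rec n (2 * j)) (2 * i) * t ^ (2 * i))"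
proof -
  have "poly (gegenbauer_rec n (2 * j)) t = (\<Sum>i\<le>2 * j. coeff (gegenbauer_rec n (2 * j)) i * t ^ i)"
    using arg_cong[OF poly_as_sum_of_monoms'[OF degree_gegenbauer_rec_le], of "\<lambda>p. poly p t" n "2 * j"]
    by (simp add: poly_sum poly_monom)
  also have "\<dots> = (\<Sum>i\<in>(\<lambda>i. 2 * i) ` {..j}. coeff (gegenbauer_rec n (2 * j)) i * t ^ i)"
  proof (rule sum.mono_neutral_right)
    show "\<forall>i\<in>{..2 * j} - (\<lambda>i. 2 * i) ` {..j}. coeff (gegenbauer_rec n (2 * j)) i * t ^ i = 0"
    proof
      fix i assume i: "i \<in> {..2 * j} - (\<lambda>i. 2 * i) ` {..j}"
      have "odd i"
      proof
        assume "even i"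
        then obtain m where "i = 2 * m" by blast
        then show False using i by auto
      qed
      then show "coeff (gegenbauer_rec n (2 * j)) i * t ^ i = 0" by (simp add: coeff_gegenbauer_rec_parity)
    qed
  qed auto
  also have "\<dots> = (\<Sum>i\<le>j. coeff (gegenbauer_rec n (2 * j)) (2 * i) * t ^ (2 * i))"
    by (subst sum.reindex) (auto simp: inj_on_def)
  finally show ?thesis .
qed

section \<open>Designs and constant potentials\<close>

lemma gegenbauer_rec_even_expansion:
  "gegenbauer_rec n (2 * j) = (\<Sum>i\<le>j. monom (coeff (gegenbauer_rec n (2 * j)) (2 * i)) (2 * i))"
proof -
  have "poly (gegenbauer_rec n (2 * j)) = poly (\<Sum>i\<le>j. monom (coeff (gegenbauer_rec n (2 * j)) (2 * i)) (2 * i))"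
    by (rule ext) (simp add: poly_gegenbauer_rec_even poly_sum poly_monom)
  then show ?thesis by (simp only: poly_eq_poly_eq_iff)
qed

text \<open>Orthogonality to the constants. Since the weight moments are proportional to the moments of the sphere, this
  says that the mean of \<open>y \<mapsto> poly (gegenbauer_rec n (2 * j)) (z \<bullet> y)\<close> over the sphere is 0.\<close>

lemma gegenbauer_rec_even_mean_zero:
  assumes "n \<ge> 2" "j \<ge> 1"
  shows "(\<Sum>i\<le>j. coeff (gegenbauer_rec n (2 * j)) (2 * i) * sphere_moment n i) = 0"
proof -
  have "0 = weight_integral n (gegenbauer_rec n (2 * j))"
    using weight_integral_gegenbauer_rec_monom[OF assms(1), of "2 * j" 0] assms(2) by (simp add: gegenbauer_moment_zero)
  also have "\<dots> = (\<Sum>i\<le>j. weight_integral n (smult (coeff (gegenbauer_rec n (2 * j)) (2 * i)) (monom 1 (2 * i))))"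
    by (subst gegenbauer_rec_even_expansion) (simp add: weight_integral_sum assms(1) smult_monom)
  also have "\<dots> = weight_integral n 1 * (\<Sum>i\<le>j. coeff (gegenbauer_rec n (2 * j)) (2 * i) * sphere_moment n i)"
    by (simp only: weight_integral_smult[OF assms(1)] weight_integral_monom[OF assms(1)] gegenbauer_moment_0_even[OF assms(1)]
        sum_distrib_left mult.left_commute)
  finally show ?thesis using weight_integral_1_pos[OF assms(1)] by simp
qed

text \<open>Let \<open>s j\<close> be the defect of the equation with index \<open>j\<close>. Since the Gegenbauer polynomials have mean 0,
  the sum over pairs for degree \<open>2 * j\<close> is \<open>\<Sum>i\<le>j. a j i * s i\<close> with \<open>a j j > 0\<close>. Also \<open>s 0 = 0\<close>, so
  the triangular system has only the zero solution.\<close>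

lemma kk_design_iff_moments:
  fixes C :: "(real ^ 'n) set"
  assumes n: "CARD('n) \<ge> 2" and C: "is_code C"
  shows "is_kk_design k C \<longleftrightarrow>
    (\<forall>j\<in>{1..k}. (\<Sum>x\<in>C. \<Sum>y\<in>C. (x \<bullet> y) ^ (2 * j)) = sphere_moment CARD('n) j * (real (card C))\<^sup>2)"
proof -
  define a where "a j i = coeff (gegenbauer_rec CARD('n) (2 * j)) (2 * i)" for j i
  define s where "s j = (\<Sum>x\<in>C. \<Sum>y\<in>C. (x \<bullet> y) ^ (2 * j)) - sphere_moment CARD('n) j * (real (card C))\<^sup>2" for j
  have s0: "s 0 = 0" by (simp add: s_def sphere_moment_def power2_eq_square)
  have pos: "a j j > 0" for j
    using lead_coeff_gegenbauer_rec_pos[OF n] by (simp add: a_def)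
  have expand: "(\<Sum>x\<in>C. \<Sum>y\<in>C. poly (gegenbauer CARD('n) (2 * j)) (x \<bullet> y)) = (\<Sum>i\<le>j. a j i * s i)"
    if "j \<ge> 1" for j
  proof -
    have "(\<Sum>x\<in>C. \<Sum>y\<in>C. poly (gegenbauer CARD('n) (2 * j)) (x \<bullet> y))
        = (\<Sum>x\<in>C. \<Sum>y\<in>C. \<Sum>i\<le>j. a j i * (x \<bullet> y) ^ (2 * i))"
      by (simp add: gegenbauer_eq[OF n] poly_gegenbauer_rec_even a_def)
    also have "\<dots> = (\<Sum>x\<in>C. \<Sum>i\<le>j. \<Sum>y\<in>C. a j i * (x \<bullet> y) ^ (2 * i))"
      by (intro sum.cong refl sum.swap)
    also have "\<dots> = (\<Sum>i\<le>j. \<Sum>x\<in>C. \<Sum>y\<in>C. a j i * (x \<bullet> y) ^ (2 * i))"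
      by (rule sum.swap)
    also have "\<dots> = (\<Sum>i\<le>j. a j i * (s i + sphere_moment CARD('n) i * (real (card C))\<^sup>2))"
      by (simp add: s_def sum_distrib_left)
    also have "\<dots> = (\<Sum>i\<le>j. a j i * s i)
        + (\<Sum>i\<le>j. a j i * sphere_moment CARD('n) i) * (real (card C))\<^sup>2"
      by (simp add: ring_distribs sum.distrib sum_distrib_right mult.assoc)
    finally show ?thesis
      using gegenbauer_rec_even_mean_zero[OF n that] by (simp add: a_def)
  qed
  have "is_kk_design k C \<longleftrightarrow> (\<forall>j\<in>{1..k}. (\<Sum>i\<le>j. a j i * s i) = 0)"
    using C by (simp add: is_kk_design_def expand)
  also have "\<dots> \<longleftrightarrow> (\<forall>j\<in>{1..k}. s j = 0)"
  proof
    assume L: "\<forall>j\<in>{1..k}. (\<Sum>i\<le>j. a j i * s i) = 0"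
    have "s j = 0" if "j \<le> k" for j
      using that
    proof (induction j rule: less_induct)
      case (less j)
      show ?case
      proof (cases "j = 0")
        case False
        have "(\<Sum>i\<le>j. a j i * s i) = a j j * s j"
          by (subst sum.remove[of _ j]) (use less in \<open>auto intro!: sum.neutral\<close>)
        moreover have "(\<Sum>i\<le>j. a j i * s i) = 0"
          using L False less.prems by auto
        ultimately show ?thesis using pos[of j] by simp
      qed (simp add: s0)
    qed
    then show "\<forall>j\<in>{1..k}. s j = 0" by simp
  next
    assume R: "\<forall>j\<in>{1..k}. s j = 0"
    have "s i = 0" if "i \<le> k" for i
      using R s0 that by (cases "i = 0") auto
    then show "\<forall>j\<in>{1..k}. (\<Sum>i\<le>j. a j i * s i) = 0"
      by (auto intro!: sum.neutral)
  qed
  finally show ?thesis by (simp add: s_def)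
qed

text \<open>A design has the energy that \<open>tensor_moment_identity\<close> asks for. Conversely, a constant potential
  of exponent \<open>2 * k\<close> makes the lower even ones constant (\<open>moment_eq_sphere_moment\<close> for the counting measure), and
  summing these over the code gives the moment equations.\<close>

lemma kk_design_iff_potential_const:
  fixes C :: "(real ^ 'n) set"
  assumes n: "CARD('n) \<ge> 2" and C: "is_code C" and k: "k \<ge> 1"
  shows "is_kk_design k C \<longleftrightarrow>
    (\<forall>x\<in>sphere 0 1. potential (\<lambda>t. t ^ (2 * k)) x C = sphere_moment CARD('n) k * real (card C))"
proof
  assume "is_kk_design k C"
  then have "(\<Sum>x\<in>C. \<Sum>y\<in>C. (x \<bullet> y) ^ (2 * k)) = sphere_moment CARD('n) k * (real (card C))\<^sup>2"
    using kk_design_iff_moments[OF n C] k by auto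
  from unit_ball.tensor_moment_identity[OF unit_ball_moment unit_ball_uniform_mass _ _ this]
  show "\<forall>x\<in>sphere 0 1. potential (\<lambda>t. t ^ (2 * k)) x C = sphere_moment CARD('n) k * real (card C)"
    using C by (simp add: is_code_def potential_def)
next
  assume const: "\<forall>x\<in>sphere 0 1. potential (\<lambda>t. t ^ (2 * k)) x C = sphere_moment CARD('n) k * real (card C)"
  have fin: "finite C" and unit: "\<And>x. x \<in> C \<Longrightarrow> norm x = 1"
    using C by (auto simp: is_code_def)
  interpret code: sphere_vector "count_space C" "\<lambda>x. x"
    using fin unit
    by (intro sphere_vector.intro finite_measure_count_space sphere_vector_axioms.intro)
       (simp_all add: AE_count_space)
  have lower: "(\<Sum>y\<in>C. (z \<bullet> y) ^ (2 * j)) = real (card C) * sphere_moment CARD('n) j"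
    if "j \<le> k" "norm z = 1" for j z
    using code.moment_eq_sphere_moment[of k "sphere_moment CARD('n) k * real (card C)" j z] that const fin
    by (simp add: lebesgue_integral_count_space_finite potential_def measure_count_space)
  have "(\<Sum>x\<in>C. \<Sum>y\<in>C. (x \<bullet> y) ^ (2 * j)) = sphere_moment CARD('n) j * (real (card C))\<^sup>2" if "j \<le> k" for j
    using lower[OF that] unit by (simp add: power2_eq_square)
  then show "is_kk_design k C"
    using kk_design_iff_moments[OF n C] by simp
qed

section \<open>Polarization bounds\<close>

lemma continuous_on_potential_power:
  "continuous_on S (\<lambda>x. potential (\<lambda>t. t ^ m) x C)"
  unfolding potential_def by (intro continuous_intros)

lemma
  fixes C :: "(real ^ 'n) set"
  shows integrable_potential:
      "integrable unit_ball_uniform (\<lambda>w. potential (\<lambda>t. t ^ m) (sgn w) C)"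
    and mean_potential: "C \<subseteq> sphere 0 1 \<Longrightarrow>
      (\<integral>w. potential (\<lambda>t. t ^ (2 * k)) (sgn w) C \<partial>unit_ball_uniform) = sphere_moment CARD('n) k * real (card C)"
proof -
  have int: "integrable unit_ball_uniform (\<lambda>w. (sgn w \<bullet> y) ^ m)" for y :: "real ^ 'n" and m
    using unit_ball.integrable_inner_power[of y m] by (simp add: inner_commute)
  then show "integrable unit_ball_uniform (\<lambda>w. potential (\<lambda>t. t ^ m) (sgn w) C)"
    by (simp add: potential_def)
  assume C: "C \<subseteq> sphere 0 1"
  have "(\<integral>w. potential (\<lambda>t. t ^ (2 * k)) (sgn w) C \<partial>unit_ball_uniform)
      = (\<Sum>y\<in>C. \<integral>w. (sgn w \<bullet> y) ^ (2 * k) \<partial>unit_ball_uniform)"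
    unfolding potential_def by (rule Bochner_Integration.integral_sum) (rule int)
  also have "\<dots> = (\<Sum>y\<in>C. sphere_moment CARD('n) k)"
  proof (rule sum.cong[OF refl])
    fix y assume "y \<in> C"
    then have "norm y = 1" using C by auto
    then show "(\<integral>w. (sgn w \<bullet> y) ^ (2 * k) \<partial>unit_ball_uniform) = sphere_moment CARD('n) k"
      using unit_ball_moment[of y k] by (simp add: inner_commute)
  qed
  finally show "(\<integral>w. potential (\<lambda>t. t ^ (2 * k)) (sgn w) C \<partial>unit_ball_uniform) = sphere_moment CARD('n) k * real (card C)"
    by simp
qed

lemma extremum_vs_mean:
  fixes C :: "(real ^ 'n) set" and k :: nat
  assumes C: "is_code C"
  defines "A \<equiv> sphere_moment CARD('n) k * real (card C)"
    and "U \<equiv> (\<lambda>x. potential (\<lambda>t. t ^ (2 * k)) x C)"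
  shows "pot_inf (\<lambda>t. t ^ (2 * k)) C \<le> A" and "A \<le> pot_sup (\<lambda>t. t ^ (2 * k)) C"
    and "pot_inf (\<lambda>t. t ^ (2 * k)) C = A \<longleftrightarrow> (\<forall>x\<in>sphere 0 1. U x = A)"
    and "A = pot_sup (\<lambda>t. t ^ (2 * k)) C \<longleftrightarrow> (\<forall>x\<in>sphere 0 1. U x = A)"
proof -
  have mean: "(\<integral>w. U (sgn w) \<partial>unit_ball_uniform) = A" and int: "integrable unit_ball_uniform (\<lambda>w. U (sgn w))"
    using C by (simp_all add: is_code_def U_def A_def mean_potential integrable_potential)
  have cont: "continuous_on (sphere 0 1) U"
    unfolding U_def by (rule continuous_on_potential_power)
  have "bounded (U ` sphere 0 1)"
    by (intro compact_imp_bounded compact_continuous_image cont compact_sphere)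
  then have bdd: "bdd_below (U ` sphere 0 1)" "bdd_above (U ` sphere 0 1)"
    by (rule bounded_imp_bdd_below bounded_imp_bdd_above)+
  have ne: "sphere (0 :: real ^ 'n) 1 \<noteq> {}" by simp
  let ?m = "pot_inf (\<lambda>t. t ^ (2 * k)) C" and ?M = "pot_sup (\<lambda>t. t ^ (2 * k)) C"
  have m: "?m \<le> U x" and M: "U x \<le> ?M" if "norm x = 1" for x
    unfolding pot_inf_def pot_sup_def U_def[symmetric]
    using that bdd by (auto intro!: cINF_lower cSUP_upper)
  have above: "a \<le> A" "a = A \<Longrightarrow> norm x = 1 \<Longrightarrow> U x = A"
    if a: "\<And>x. norm x = 1 \<Longrightarrow> a \<le> U x" for a x
    using lower_bound_le_mean(1)[OF cont int a] lower_bound_le_mean(2)[OF cont int a, of x]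
    unfolding mean by blast+
  have "continuous_on (sphere 0 1) (\<lambda>x. - U x)" "integrable unit_ball_uniform (\<lambda>w. - U (sgn w))"
    "(\<integral>w. - U (sgn w) \<partial>unit_ball_uniform) = - A"
    using cont int mean by (simp_all add: continuous_on_minus)
  \<comment> \<open>the upper bounds of \<open>U\<close> are the lower bounds of \<open>-U\<close>\<close>
  note neg = lower_bound_le_mean[OF this(1,2), unfolded this(3)]
  have below: "A \<le> a" "a = A \<Longrightarrow> norm x = 1 \<Longrightarrow> U x = A"
    if a: "\<And>x. norm x = 1 \<Longrightarrow> U x \<le> a" for a x
    using neg(1)[of "- a"] neg(2)[of "- a" x] a by simp_all
  have const: "?m = A \<and> ?M = A" if "\<forall>x\<in>sphere 0 1. U x = A"
    unfolding pot_inf_def pot_sup_def U_def[symmetric] using that ne by simp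
  show "?m \<le> A" by (rule above(1)[OF m])
  show "A \<le> ?M" by (rule below(1)[OF M])
  show "?m = A \<longleftrightarrow> (\<forall>x\<in>sphere 0 1. U x = A)"
    using above(2)[OF m] const by (metis mem_sphere_0)
  show "A = ?M \<longleftrightarrow> (\<forall>x\<in>sphere 0 1. U x = A)"
    using below(2)[OF M] const by (metis mem_sphere_0)
qed

theorem theorem4p5:
  fixes k N :: nat and h :: "real \<Rightarrow> real" and c :: real
  assumes "CARD('n::finite) \<ge> 2" and "k \<ge> 1" and "N \<ge> 1"
  defines "h \<equiv> (\<lambda>t. t ^ (2 * k))"
    and "c \<equiv> sphere_moment CARD('n) k"
  shows
    "(\<forall>z :: real ^ 'n. z \<in> sphere 0 1 \<longrightarrow>
        integral\<^sup>L sphere_measure (\<lambda>y. (z \<bullet> y) ^ (2 * k)) = c) \<and>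
     (\<forall>C :: (real ^ 'n) set. is_code C \<and> card C = N \<longrightarrow>
        pot_inf h C \<le> c * real N \<and> c * real N \<le> pot_sup h C \<and>
        (pot_inf h C = c * real N \<longleftrightarrow> is_kk_design k C) \<and>
        (c * real N = pot_sup h C \<longleftrightarrow> is_kk_design k C)) \<and>
     ((\<exists>C :: (real ^ 'n) set. card C = N \<and> is_kk_design k C) \<longrightarrow>
        maxmin_polarization TYPE('n) h N = c * real N \<and>
        minmax_polarization TYPE('n) h N = c * real N)"
proof (intro conjI)
  show "\<forall>z :: real ^ 'n. z \<in> sphere 0 1 \<longrightarrow>
        integral\<^sup>L sphere_measure (\<lambda>y. (z \<bullet> y) ^ (2 * k)) = c"
    by (simp add: integral_sphere_measure unit_ball_moment c_def)
  show codes: "\<forall>C :: (real ^ 'n) set. is_code C \<and> card C = N \<longrightarrow>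
        pot_inf h C \<le> c * real N \<and> c * real N \<le> pot_sup h C \<and>
        (pot_inf h C = c * real N \<longleftrightarrow> is_kk_design k C) \<and>
        (c * real N = pot_sup h C \<longleftrightarrow> is_kk_design k C)"
    using extremum_vs_mean[where 'n = 'n and k = k] kk_design_iff_potential_const[OF assms(1) _ assms(2)]
    unfolding h_def c_def by blast
  show "(\<exists>C :: (real ^ 'n) set. card C = N \<and> is_kk_design k C) \<longrightarrow>
        maxmin_polarization TYPE('n) h N = c * real N \<and>
        minmax_polarization TYPE('n) h N = c * real N"
  proof
    assume "\<exists>C :: (real ^ 'n) set. card C = N \<and> is_kk_design k C"
    then obtain C :: "(real ^ 'n) set" where C: "is_code C" "card C = N" "is_kk_design k C"
      by (auto simp: is_kk_design_def)
    then have ext: "pot_inf h C = c * real N" "pot_sup h C = c * real N"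
      using codes by metis+
    show "maxmin_polarization TYPE('n) h N = c * real N \<and>
        minmax_polarization TYPE('n) h N = c * real N"
      unfolding maxmin_polarization_def minmax_polarization_def
    proof (intro conjI cSup_eq_maximum cInf_eq_minimum)
      show "c * real N \<in> pot_inf h ` {C :: (real ^ 'n) set. is_code C \<and> card C = N}"
        "c * real N \<in> pot_sup h ` {C :: (real ^ 'n) set. is_code C \<and> card C = N}"
        using C(1,2) ext[symmetric] by blast+
    next
      fix m assume "m \<in> pot_inf h ` {C :: (real ^ 'n) set. is_code C \<and> card C = N}"
      then show "m \<le> c * real N" using codes by (auto simp del: One_nat_def)
    next
      fix m assume "m \<in> pot_sup h ` {C :: (real ^ 'n) set. is_code C \<and> card C = N}"
      then show "c * real N \<le> m" using codes by (auto simp del: One_nat_def)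
    qed
  qed
qed

end
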